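(* Let $W \in \mathbb{R}^{m \times n}$, $b \in \mathbb{R}^m$, $\alpha > 0$ and $\delta \geq 0$. Let $R : \mathbb{R}^n \to \mathbb{R}\cup\{\infty\}$ and $\Psi : \mathbb{R}^m \to \mathbb{R}\cup\{\infty\}$ satisfy the standing assumptions (A1)-(A3) listed in the context, and let $\sigma$, $B_\Psi$, $\mathcal{S}$, $\mathcal{R}_\alpha$, $J_\Psi$ be as defined there. Let $y, y^\delta \in \mathrm{dom}(\Psi)$ and let $x^\dagger \in \mathbb{R}^n$ be such that \begin{itemize} \item $y = \sigma(W x^\dagger + b)$ and $x^\dagger \in \mathcal{S}(y)$; \item $x^\dagger$ satisfies the source condition: there is $v^\dagger \in \mathbb{R}^m$ with $W^\ast v^\dagger \in \partial R(x^\dagger)$; \item $B_\Psi(y^\delta, W x^\dagger + b) \leq \delta^2$. \end{itemize} Let $x_\alpha \in \mathcal{R}_\alpha(y^\delta)$, i.e. $x_\alpha$ is a minimiser over $x \in \mathbb{R}^n$ of $B_\Psi(y^\delta, W x + b) + \alpha R(x)$. Then for every constant $c \in (0,1]$ such that $y^\delta + \frac{\alpha}{c} v^\dagger$ and $y^\delta - \frac{\alpha}{c} v^\dagger$ both belong to $\mathrm{dom}(\Psi)$, \[ (1 - c)\, B_\Psi(y^\delta, W x_\alpha + b) + \alpha\, D_R^{\mathrm{symm}}(x_\alpha, x^\dagger) \;\leq\; (1 + c)\,\delta^2 + \frac{\alpha^2}{c} \| v^\dagger \|^2 + 2c\, J_\Psi\!\left( y^\delta + \frac{\alpha}{c} v^\dagger,\;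 y^\delta - \frac{\alpha}{c} v^\dagger \right), \] where $D_R^{\mathrm{symm}}(x_\alpha, x^\dagger) = \langle x_\alpha - x^\dagger, p_\alpha - p^\dagger \rangle$ is the symmetric Bregman distance formed with the subgradients $p_\alpha = \frac{1}{\alpha} W^\ast\left( y^\delta - \sigma(W x_\alpha + b) \right) \in \partial R(x_\alpha)$ (given by the optimality condition for $x_\alpha$) and $p^\dagger = W^\ast v^\dagger \in \partial R(x^\dagger)$.
   Context: All norms $\|\cdot\|$ are Euclidean, $\langle\cdot,\cdot\rangle$ is the Euclidean inner product, and $W^\ast$ is the transpose of $W$. For an extended-valued function $F$, $\mathrm{dom}(F) = \{ x : F(x) < \infty\}$, $F^\ast(w) = \sup_x \langle x, w\rangle - F(x)$ is the Fenchel conjugate, and $\partial F$ is the convex subdifferential. Definitions. \begin{itemize} \item Activation function: $\sigma(z) = \mathrm{prox}_\Psi(z) = \arg\min_{u \in \mathbb{R}^m} \{ \frac12 \|u - z\|^2 + \Psi(u) \}$. \item Lifted Bregman loss: $B_\Psi(u, z) = \frac12\|u\|^2 + \Psi(u) + \left(\frac12\|\cdot\|^2 + \Psi\right)^\ast(z) - \langle u, z\rangle$, for $u \in \mathrm{dom}(\Psi)$, $z \in \mathbb{R}^m$. (The gradient of $z \mapsto B_\Psi(u,z)$ is $\sigma(z) - u$.) \item Regularisation operator: $\mathcal{R}_\alpha(g) = \arg\min_{x \in \mathbb{R}^n} \{ B_\Psi(g, Wx + b) + \alpha R(x) \}$ (a set), for $g \in \mathrm{dom}(\Psi)$. \item Selection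 operator: $\mathcal{S}(g) = \arg\min_{x \in \mathbb{R}^n} \{ R(x) \mid x \in \arg\min_{\tilde{x} \in \mathbb{R}^n} B_\Psi(g, W\tilde{x} + b) \}$. \item Bregman distance: $D_R(x,\tilde x) = R(x) - R(\tilde x) - \langle \tilde q, x - \tilde x\rangle$ for $\tilde q \in \partial R(\tilde x)$. Symmetric Bregman distance: $D_R^{\mathrm{symm}}(x, \tilde x) = D_R(x,\tilde x) + D_R(\tilde x, x) = \langle x - \tilde x, q - \tilde q\rangle$ for chosen $q \in \partial R(x)$, $\tilde q \in \partial R(\tilde x)$. \item Burbea-Rao divergence: $J_\Psi(u, \tilde u) = \frac12\left( \Psi(u) + \Psi(\tilde u) - 2\Psi\left(\frac{u + \tilde u}{2}\right) \right)$ for $u, \tilde u \in \mathrm{dom}(\Psi)$. \end{itemize} Standing assumptions. \begin{itemize} \item (A1) $R$ is proper, convex, lower semi-continuous and non-negative, and $R = H^\ast$ for some proper function $H : \mathbb{R}^n \to \mathbb{R}\cup\{\infty\}$. \item (A2) $\Psi$ is proper, convex, lower semi-continuous, non-negative, and continuous on $\mathrm{dom}(\Psi)$. \item (A3) For each $g \in \mathrm{dom}(\Psi)$, $\alpha > 0$ and constants $a, d$: if $B_\Psi(g, Wx + b) \leq a$ and $\alpha R(x) \leq d$, then $\|x\| \leq \kappa(a, d, \|g\|)$, where $\kappa$ is a real-valued function that is monotonically non-decreasing in all its arguments. \end{itemize} *)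

theory Defs
  imports "HOL-Analysis.Analysis"
begin

text \<open>Functions into \<open>\<real> \<union> {\<infinity>}\<close> are modelled as \<^typ>\<open>ereal\<close>-valued functions;
  properness excludes the value \<open>-\<infinity>\<close>.\<close>

definition effective_domain :: "('a \<Rightarrow> ereal) \<Rightarrow> 'a set" where
  "effective_domain F = {x. F x < \<infinity>}"

definition proper_fun :: "('a \<Rightarrow> ereal) \<Rightarrow> bool" where
  "proper_fun F \<longleftrightarrow> (\<forall>x. F x \<noteq> -\<infinity>) \<and> (\<exists>x. F x < \<infinity>)"

text \<open>Only used for functions that avoid \<open>-\<infinity>\<close>, so the right-hand side never has the form
  \<open>\<infinity> - \<infinity>\<close>; at the end points of the segment it relies on \<open>0 * \<infinity> = 0\<close>.\<close>

definition convex_fun :: "('a::real_vector \<Rightarrow> ereal) \<Rightarrow> bool" where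
  "convex_fun F \<longleftrightarrow> (\<forall>x y. \<forall>s\<ge>0. \<forall>t\<ge>0. s + t = 1 \<longrightarrow>
     F (s *\<^sub>R x + t *\<^sub>R y) \<le> ereal s * F x + ereal t * F y)"

definition lsc_fun :: "('a::topological_space \<Rightarrow> ereal) \<Rightarrow> bool" where
  "lsc_fun F \<longleftrightarrow> (\<forall>x. F x \<le> Liminf (at x) F)"

definition fenchel_conjugate :: "('a::real_inner \<Rightarrow> ereal) \<Rightarrow> 'a \<Rightarrow> ereal" where
  "fenchel_conjugate F w = (SUP x. ereal (x \<bullet> w) - F x)"

text \<open>For proper \<open>F\<close> this set is empty at every point outside the effective domain.\<close>

definition subdifferential :: "('a::real_inner \<Rightarrow> ereal) \<Rightarrow> 'a \<Rightarrow> 'a set" where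
  "subdifferential F x = {q. \<forall>y. F x + ereal (q \<bullet> (y - x)) \<le> F y}"

definition prox :: "('a::real_inner \<Rightarrow> ereal) \<Rightarrow> 'a \<Rightarrow> 'a" where
  "prox \<Psi> z = arg_min (\<lambda>u. ereal (1/2 * (norm (u - z))\<^sup>2) + \<Psi> u) (\<lambda>_. True)"

definition bregman_loss :: "('a::real_inner \<Rightarrow> ereal) \<Rightarrow> 'a \<Rightarrow> 'a \<Rightarrow> ereal" where
  "bregman_loss \<Psi> u z =
     ereal (1/2 * (norm u)\<^sup>2) + \<Psi> u
     + fenchel_conjugate (\<lambda>v. ereal (1/2 * (norm v)\<^sup>2) + \<Psi> v) z
     - ereal (u \<bullet> z)"

definition regularisation_op ::
  "(real^'n \<Rightarrow> ereal) \<Rightarrow> (real^'m \<Rightarrow> ereal) \<Rightarrow> real^'n^'m \<Rightarrow> real^'m \<Rightarrow> real \<Rightarrow> real^'m \<Rightarrow> (real^'n) set"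
  where
  "regularisation_op R \<Psi> W b \<alpha> g =
     {x. is_arg_min (\<lambda>x. bregman_loss \<Psi> g (W *v x + b) + ereal \<alpha> * R x) (\<lambda>_. True) x}"

definition selection_op ::
  "(real^'n \<Rightarrow> ereal) \<Rightarrow> (real^'m \<Rightarrow> ereal) \<Rightarrow> real^'n^'m \<Rightarrow> real^'m \<Rightarrow> real^'m \<Rightarrow> (real^'n) set"
  where
  "selection_op R \<Psi> W b g =
     {x. is_arg_min R (is_arg_min (\<lambda>x. bregman_loss \<Psi> g (W *v x + b)) (\<lambda>_. True)) x}"

text \<open>\<open>bregman_distance R q' x x'\<close> is meaningful for \<open>q' \<in> subdifferential R x'\<close>, and
  \<open>symm_bregman_distance R q q' x x'\<close> if moreover \<open>q \<in> subdifferential R x\<close>.\<close>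

definition bregman_distance :: "('a::real_inner \<Rightarrow> ereal) \<Rightarrow> 'a \<Rightarrow> 'a \<Rightarrow> 'a \<Rightarrow> ereal" where
  "bregman_distance R q' x x' = R x - R x' - ereal (q' \<bullet> (x - x'))"

definition symm_bregman_distance :: "('a::real_inner \<Rightarrow> ereal) \<Rightarrow> 'a \<Rightarrow> 'a \<Rightarrow> 'a \<Rightarrow> 'a \<Rightarrow> ereal" where
  "symm_bregman_distance R q q' x x' = bregman_distance R q' x x' + bregman_distance R q x' x"

definition burbea_rao :: "('a::real_vector \<Rightarrow> ereal) \<Rightarrow> 'a \<Rightarrow> 'a \<Rightarrow> ereal" where
  "burbea_rao \<Psi> u v = ereal (1/2) * (\<Psi> u + \<Psi> v - 2 * \<Psi> ((u + v) /\<^sub>R 2))"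

definition admissible_regulariser :: "('a::real_inner \<Rightarrow> ereal) \<Rightarrow> bool" where
  "admissible_regulariser R \<longleftrightarrow>
     proper_fun R \<and> convex_fun R \<and> lsc_fun R \<and> (\<forall>x. 0 \<le> R x) \<and>
     (\<exists>H. proper_fun H \<and> R = fenchel_conjugate H)"

definition admissible_potential :: "('a::real_inner \<Rightarrow> ereal) \<Rightarrow> bool" where
  "admissible_potential \<Psi> \<longleftrightarrow>
     proper_fun \<Psi> \<and> convex_fun \<Psi> \<and> lsc_fun \<Psi> \<and> (\<forall>u. 0 \<le> \<Psi> u) \<and>
     continuous_on (effective_domain \<Psi>) \<Psi>"

text \<open>The bound \<open>\<kappa>\<close> is a single function of three real arguments, chosen independently of
  \<open>g\<close>, \<open>\<alpha>\<close>, \<open>a\<close> and \<open>d\<close>.\<close>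

definition coercivity_condition ::
  "(real^'n \<Rightarrow> ereal) \<Rightarrow> (real^'m \<Rightarrow> ereal) \<Rightarrow> real^'n^'m \<Rightarrow> real^'m \<Rightarrow> bool" where
  "coercivity_condition R \<Psi> W b \<longleftrightarrow>
     (\<exists>\<kappa> :: real \<Rightarrow> real \<Rightarrow> real \<Rightarrow> real.
        (\<forall>a a' d d' r r'. a \<le> a' \<longrightarrow> d \<le> d' \<longrightarrow> r \<le> r' \<longrightarrow> \<kappa> a d r \<le> \<kappa> a' d' r') \<and>
        (\<forall>g \<in> effective_domain \<Psi>. \<forall>\<alpha>>0. \<forall>a d x.
           bregman_loss \<Psi> g (W *v x + b) \<le> ereal a \<longrightarrow> ereal \<alpha> * R x \<le> ereal d \<longrightarrow>
           norm x \<le> \<kappa> a d (norm g)))"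

end

theory Submission
  imports Defs
begin

text \<open>Put \<open>\<Phi> = 1/2 \<parallel>\<cdot>\<parallel>\<^sup>2 + \<Psi>\<close>. Strong convexity of \<open>\<Phi>\<close> makes \<open>\<Phi>\<^sup>*\<close> differentiable
  with gradient \<open>prox \<Psi>\<close>, up to a quadratic error, and this yields the optimality condition
  \<open>p\<alpha> \<in> \<partial>R(x\<alpha>)\<close>. Write \<open>z\<alpha> = W x\<alpha> + b\<close> and \<open>z\<^sup>\<dagger> = W x\<^sup>\<dagger> + b\<close>. The gradient
  inequality for \<open>\<Phi>\<^sup>*\<close> bounds \<open>\<langle>z\<alpha> - z\<^sup>\<dagger>, y\<delta> - \<sigma>(z\<alpha>)\<rangle>\<close> by
  \<open>B(y\<delta>, z\<^sup>\<dagger>) - B(y\<delta>, z\<alpha>)\<close>. The remaining term \<open>\<alpha> \<langle>z\<^sup>\<dagger> - z\<alpha>, v\<^sup>\<dagger>\<rangle>\<close> is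
  absorbed by the Fenchel-Young inequality at the two pairs
  \<open>(y\<delta> + (\<alpha>/c) v\<^sup>\<dagger>, z\<^sup>\<dagger>)\<close> and \<open>(y\<delta> - (\<alpha>/c) v\<^sup>\<dagger>, z\<alpha>)\<close>; together
  with \<open>- 2 \<Phi>(y\<delta>)\<close> from the two losses, their \<open>\<Phi>\<close>-values form twice the Burbea-Rao
  divergence of \<open>\<Phi>\<close>, which is that of \<open>\<Psi>\<close> plus the quadratic term in \<open>v\<^sup>\<dagger>\<close>.\<close>

section \<open>Lower semicontinuity and existence of minimisers\<close>

lemma lsc_fun_open_superlevel:
  fixes F :: "'a::topological_space \<Rightarrow> ereal"
  assumes "lsc_fun F"
  shows "open {x. c < F x}"
proof (subst open_subopen, intro ballI)
  fix x assume x: "x \<in> {x. c < F x}"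
  then have "c < Liminf (at x) F"
    using assms unfolding lsc_fun_def by (auto intro: less_le_trans)
  then have "eventually (\<lambda>u. c < F u) (at x)"
    by (rule less_LiminfD)
  then have "eventually (\<lambda>u. c < F u) (nhds x)"
    using x by (simp add: eventually_nhds_conv_at)
  then show "\<exists>T. open T \<and> x \<in> T \<and> T \<subseteq> {x. c < F x}"
    unfolding eventually_nhds by blast
qed

text \<open>If no point were minimal, the open superlevel sets \<open>{x. F y < F x}\<close> with
  \<open>y\<close> in the sublevel set would cover that compact set. In a finite subcover, the index
  \<open>y\<close> with least \<open>F y\<close> lies in none of the chosen sets, a
  contradiction.\<close>

lemma lsc_fun_attains_min:
  fixes F :: "'a::topological_space \<Rightarrow> ereal"
  assumes lsc: "lsc_fun F" and K: "compact {x. F x \<le> F x0}"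
  obtains x where "\<And>y. F x \<le> F y"
proof -
  let ?K = "{x. F x \<le> F x0}"
  have "\<exists>x. \<forall>y. F x \<le> F y"
  proof (rule ccontr)
    assume "\<not> ?thesis"
    then have below: "\<exists>y. F y < F x" for x
      by (auto simp: not_le)
    have cover: "?K \<subseteq> (\<Union>y\<in>?K. {x. F y < F x})"
    proof
      fix x assume "x \<in> ?K"
      moreover obtain y where "F y < F x"
        using below by blast
      ultimately show "x \<in> (\<Union>y\<in>?K. {x. F y < F x})"
        by (auto intro: order.trans less_imp_le)
    qed
    obtain C where C: "C \<subseteq> ?K" "finite C" "?K \<subseteq> (\<Union>y\<in>C. {x. F y < F x})"
      using compactE_image[OF K, of ?K "\<lambda>y. {x. F y < F x}"] cover
        lsc_fun_open_superlevel[OF lsc] by blast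
    then have "C \<noteq> {}"
      by auto
    then obtain y where y: "y \<in> C" "\<And>u. u \<in> C \<Longrightarrow> F y \<le> F u"
      using ex_is_arg_min_if_finite[OF C(2), of F] by (auto simp: is_arg_min_linorder)
    then obtain u where "u \<in> C" "F u < F y"
      using C(1,3) by blast
    with y(2) show False
      by (simp add: leD)
  qed
  with that show ?thesis
    by blast
qed

section \<open>First-order optimality for a smooth function plus a convex one\<close>

lemma minimiser_finite:
  fixes f :: "'a \<Rightarrow> real"
  assumes "proper_fun F" and "\<And>u. ereal (f x) + F x \<le> ereal (f u) + F u"
  obtains r where "F x = ereal r"
proof -
  obtain u where "F u < \<infinity>" "\<And>u. F u \<noteq> -\<infinity>"
    using assms(1) by (auto simp: proper_fun_def)
  with assms(2)[of u] that show ?thesis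
    by (cases "F x"; cases "F u") auto
qed

text \<open>Comparing \<open>x\<close> with \<open>x + t h\<close> on the segment towards
  \<open>y\<close>, convexity bounds \<open>F\<close> and \<open>smooth\<close> bounds
  \<open>f\<close>; dividing by \<open>t\<close> and letting \<open>t\<close> tend to 0 removes the
  quadratic error. Here \<open>d\<close> acts as the gradient of \<open>f\<close> at
  \<open>x\<close>, but only a one-sided quadratic bound is required of it.\<close>

lemma subgradient_of_minimiser:
  fixes f :: "'a::real_inner \<Rightarrow> real"
  assumes conv: "convex_fun F" and proper: "proper_fun F"
    and min: "\<And>u. ereal (f x) + F x \<le> ereal (f u) + F u"
    and smooth: "\<And>h. f (x + h) \<le> f x + d \<bullet> h + C * (norm h)\<^sup>2"
  shows "- d \<in> subdifferential F x"
  unfolding subdifferential_def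
proof (intro CollectI allI)
  fix y
  obtain r where r: "F x = ereal r"
    using minimiser_finite[OF proper min] by blast
  show "F x + ereal (- d \<bullet> (y - x)) \<le> F y"
  proof (cases "F y")
    case (real s)
    define h where "h = y - x"
    have step: "r - d \<bullet> h - s \<le> t * (C * (norm h)\<^sup>2)" if t: "0 < t" "t < 1" for t
    proof -
      have "(1 - t) *\<^sub>R x + t *\<^sub>R y = x + t *\<^sub>R h"
        by (simp add: h_def algebra_simps)
      then have "F (x + t *\<^sub>R h) \<le> ereal (1 - t) * F x + ereal t * F y"
        using conv t unfolding convex_fun_def
        by (metis diff_add_cancel diff_ge_0_iff_ge less_imp_le)
      then have "F (x + t *\<^sub>R h) \<le> ereal ((1 - t) * r + t * s)"
        by (simp add: r real)
      then have "ereal (f x) + F x \<le> ereal (f (x + t *\<^sub>R h)) + ereal ((1 - t) * r + t * s)"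
        using min by (meson add_left_mono order.trans)
      then have "f x + r \<le> f (x + t *\<^sub>R h) + ((1 - t) * r + t * s)"
        by (simp add: r)
      also have "\<dots> \<le> f x + d \<bullet> (t *\<^sub>R h) + C * (norm (t *\<^sub>R h))\<^sup>2 + ((1 - t) * r + t * s)"
        by (rule add_right_mono[OF smooth])
      finally have "t * (r - d \<bullet> h - s) \<le> t * (t * (C * (norm h)\<^sup>2))"
        by (simp add: algebra_simps power2_eq_square)
      then show ?thesis
        using t by simp
    qed
    \<comment> \<open>The left-hand side of \<open>step\<close> does not depend on \<open>t\<close>,
      so it is at most the limit 0 of the right-hand side.\<close>
    have "((\<lambda>t. t * (C * (norm h)\<^sup>2)) \<longlongrightarrow> 0 * (C * (norm h)\<^sup>2)) (at_right 0)"
      by (intro tendsto_intros)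
    moreover have "eventually (\<lambda>t. r - d \<bullet> h - s \<le> t * (C * (norm h)\<^sup>2)) (at_right 0)"
      using step by (auto simp: eventually_at_right[of 0 1] intro!: exI[of _ 1])
    ultimately have "r - d \<bullet> h - s \<le> 0"
      using tendsto_lowerbound by force
    then show ?thesis
      by (simp add: r real h_def)
  qed (use proper in \<open>auto simp: proper_fun_def\<close>)
qed

section \<open>The proximal map\<close>

text \<open>Since \<open>prox\<close> is given by a choice operator, a minimiser has to be exhibited
  first. The objective is lower semicontinuous, and nonnegativity of \<open>\<Psi>\<close> keeps its
  sublevel sets in a ball around \<open>z\<close>.\<close>

lemma prox_minimises:
  fixes \<Psi> :: "'a::euclidean_space \<Rightarrow> ereal"
  assumes "admissible_potential \<Psi>"
  shows "ereal (1/2 * (norm (prox \<Psi> z - z))\<^sup>2) + \<Psi> (prox \<Psi> z)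
    \<le> ereal (1/2 * (norm (u - z))\<^sup>2) + \<Psi> u"
proof -
  define q where "q u = ereal (1/2 * (norm (u - z))\<^sup>2)" for u
  have nonneg: "0 \<le> \<Psi> u" for u
    using assms by (simp add: admissible_potential_def)
  have lsc: "lsc_fun (\<lambda>u. q u + \<Psi> u)"
    unfolding lsc_fun_def
  proof
    fix u
    have "(q \<longlongrightarrow> q u) (at u)"
      unfolding q_def by (intro tendsto_intros)
    then have "q u = Liminf (at u) q"
      by (simp add: lim_imp_Liminf)
    moreover have "\<Psi> u \<le> Liminf (at u) \<Psi>"
      using assms by (simp add: admissible_potential_def lsc_fun_def)
    moreover have "Liminf (at u) q + Liminf (at u) \<Psi> \<le> Liminf (at u) (\<lambda>u. q u + \<Psi> u)"
      by (rule Liminf_add_le) (simp_all add: nonneg q_def)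
    ultimately show "q u + \<Psi> u \<le> Liminf (at u) (\<lambda>u. q u + \<Psi> u)"
      by (metis add_left_mono order.trans)
  qed
  obtain u0 s where u0: "\<Psi> u0 = ereal s"
    using assms unfolding admissible_potential_def proper_fun_def
    by (metis ereal_cases ereal_less_PInfty less_irrefl)
  let ?c = "1/2 * (norm (u0 - z))\<^sup>2 + s"
  let ?K = "{u. q u + \<Psi> u \<le> q u0 + \<Psi> u0}"
  have "?K \<subseteq> cball z (?c + 1)"
  proof
    fix u assume "u \<in> ?K"
    then have "q u + 0 \<le> q u0 + \<Psi> u0"
      using nonneg by (metis (mono_tags, lifting) add_left_mono mem_Collect_eq order.trans)
    then have "1/2 * (norm (u - z))\<^sup>2 \<le> ?c"
      by (simp add: q_def u0)
    \<comment> \<open>This linearises the quadratic bound without a square root: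
      \<open>norm (u - z)\<close> is at most half its square plus 1/2.\<close>
    moreover have "0 \<le> (norm (u - z) - 1)\<^sup>2"
      by simp
    ultimately have "norm (u - z) \<le> ?c + 1"
      by (simp add: power2_diff)
    then show "u \<in> cball z (?c + 1)"
      by (simp add: dist_norm norm_minus_commute)
  qed
  then have "bounded ?K"
    by (rule bounded_subset[OF bounded_cball])
  moreover have "closed ?K"
    using lsc_fun_open_superlevel[OF lsc, of "q u0 + \<Psi> u0"]
    by (simp add: closed_def Compl_eq not_le)
  ultimately have "compact ?K"
    by (simp add: compact_eq_bounded_closed)
  then obtain x where "\<And>u. q x + \<Psi> x \<le> q u + \<Psi> u"
    using lsc_fun_attains_min[OF lsc] by blast
  then have "is_arg_min (\<lambda>u. q u + \<Psi> u) (\<lambda>_. True) x"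
    by (simp add: is_arg_min_linorder)
  then have "is_arg_min (\<lambda>u. q u + \<Psi> u) (\<lambda>_. True) (prox \<Psi> z)"
    unfolding prox_def arg_min_def q_def by (rule someI)
  then show ?thesis
    by (simp add: is_arg_min_linorder q_def)
qed

lemma prox_in_domain:
  fixes \<Psi> :: "'a::euclidean_space \<Rightarrow> ereal"
  assumes "admissible_potential \<Psi>"
  obtains r where "\<Psi> (prox \<Psi> z) = ereal r"
  by (rule minimiser_finite[where f = "\<lambda>u. 1/2 * (norm (u - z))\<^sup>2" and F = \<Psi> and x = "prox \<Psi> z"])
    (use assms prox_minimises[OF assms] that in \<open>auto simp: admissible_potential_def\<close>)

text \<open>The quadratic \<open>1/2 * (norm (u - z))\<^sup>2\<close> has gradient
  \<open>prox \<Psi> z - z\<close> at the minimiser, and its second-order expansion is exact with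
  \<open>C = 1/2\<close>.\<close>

lemma prox_subgradient:
  fixes \<Psi> :: "'a::euclidean_space \<Rightarrow> ereal"
  assumes "admissible_potential \<Psi>"
  shows "z - prox \<Psi> z \<in> subdifferential \<Psi> (prox \<Psi> z)"
proof -
  let ?x = "prox \<Psi> z"
  have "- (?x - z) \<in> subdifferential \<Psi> ?x"
  proof (rule subgradient_of_minimiser[where f = "\<lambda>u. 1/2 * (norm (u - z))\<^sup>2" and C = "1/2"])
    show "convex_fun \<Psi>" "proper_fun \<Psi>"
      using assms by (simp_all add: admissible_potential_def)
    show "ereal (1/2 * (norm (?x - z))\<^sup>2) + \<Psi> ?x \<le> ereal (1/2 * (norm (u - z))\<^sup>2) + \<Psi> u" for u
      by (rule prox_minimises[OF assms])
    show "1/2 * (norm (?x + h - z))\<^sup>2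
        \<le> 1/2 * (norm (?x - z))\<^sup>2 + (?x - z) \<bullet> h + 1/2 * (norm h)\<^sup>2" for h
      by (simp add: power2_norm_eq_inner algebra_simps inner_commute)
  qed
  then show ?thesis
    by simp
qed

section \<open>The conjugate of the quadratically shifted potential\<close>

text \<open>A real-valued version permits ordinary arithmetic; for admissible potentials
  \<open>fenchel_conjugate_finite\<close> shows that the conversion loses nothing.\<close>

definition potential_conjugate :: "('a::real_inner \<Rightarrow> ereal) \<Rightarrow> 'a \<Rightarrow> real" where
  "potential_conjugate \<Psi> z
     = real_of_ereal (fenchel_conjugate (\<lambda>v. ereal (1/2 * (norm v)\<^sup>2) + \<Psi> v) z)"

text \<open>The subgradient \<open>z - prox \<Psi> z\<close> gives an affine minorant of
  \<open>\<Psi>\<close>, so the supremum is at most that of a concave quadratic. The case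
  \<open>z' = z\<close> yields the value of the conjugate at \<open>z\<close>, general
  \<open>z'\<close> its quadratic upper bound.\<close>

lemma fenchel_conjugate_le:
  fixes \<Psi> :: "'a::euclidean_space \<Rightarrow> ereal"
  assumes adm: "admissible_potential \<Psi>" and r: "\<Psi> (prox \<Psi> z) = ereal r"
  shows "fenchel_conjugate (\<lambda>v. ereal (1/2 * (norm v)\<^sup>2) + \<Psi> v) z'
    \<le> ereal (prox \<Psi> z \<bullet> z' - 1/2 * (norm (prox \<Psi> z))\<^sup>2 - r + 1/2 * (norm (z' - z))\<^sup>2)"
  unfolding fenchel_conjugate_def
proof (rule SUP_least)
  fix x
  let ?p = "prox \<Psi> z"
  show "ereal (x \<bullet> z') - (ereal (1/2 * (norm x)\<^sup>2) + \<Psi> x)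
    \<le> ereal (?p \<bullet> z' - 1/2 * (norm ?p)\<^sup>2 - r + 1/2 * (norm (z' - z))\<^sup>2)"
  proof (cases "\<Psi> x")
    case (real s)
    have "\<Psi> ?p + ereal ((z - ?p) \<bullet> (x - ?p)) \<le> \<Psi> x"
      using prox_subgradient[OF adm, of z] by (simp add: subdifferential_def)
    then have "r + (z - ?p) \<bullet> (x - ?p) \<le> s"
      by (simp add: r real)
    \<comment> \<open>Completing the square: the concave quadratic is maximal at
      \<open>x = ?p + (z' - z)\<close>.\<close>
    moreover have "0 \<le> (norm (x - ?p - (z' - z)))\<^sup>2"
      by simp
    ultimately show ?thesis
      by (simp add: real power2_norm_eq_inner algebra_simps inner_commute)
  qed (use adm in \<open>auto simp: admissible_potential_def proper_fun_def\<close>)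
qed

lemma fenchel_young:
  assumes "\<Psi> u = ereal s"
  shows "ereal (u \<bullet> z - 1/2 * (norm u)\<^sup>2 - s)
    \<le> fenchel_conjugate (\<lambda>v. ereal (1/2 * (norm v)\<^sup>2) + \<Psi> v) z"
proof -
  have "ereal (u \<bullet> z - 1/2 * (norm u)\<^sup>2 - s) = ereal (u \<bullet> z) - (ereal (1/2 * (norm u)\<^sup>2) + \<Psi> u)"
    by (simp add: assms)
  also have "\<dots> \<le> fenchel_conjugate (\<lambda>v. ereal (1/2 * (norm v)\<^sup>2) + \<Psi> v) z"
    unfolding fenchel_conjugate_def by (rule SUP_upper) simp
  finally show ?thesis .
qed

lemma fenchel_conjugate_prox:
  fixes \<Psi> :: "'a::euclidean_space \<Rightarrow> ereal"
  assumes "admissible_potential \<Psi>" "\<Psi> (prox \<Psi> z) = ereal r"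
  shows "fenchel_conjugate (\<lambda>v. ereal (1/2 * (norm v)\<^sup>2) + \<Psi> v) z
    = ereal (prox \<Psi> z \<bullet> z - 1/2 * (norm (prox \<Psi> z))\<^sup>2 - r)"
  using fenchel_conjugate_le[OF assms, of z] fenchel_young[of \<Psi>, OF assms(2), of z]
  by (simp add: order.antisym)

lemma fenchel_conjugate_finite:
  fixes \<Psi> :: "'a::euclidean_space \<Rightarrow> ereal"
  assumes "admissible_potential \<Psi>"
  shows "fenchel_conjugate (\<lambda>v. ereal (1/2 * (norm v)\<^sup>2) + \<Psi> v) z
    = ereal (potential_conjugate \<Psi> z)"
proof -
  obtain r where "\<Psi> (prox \<Psi> z) = ereal r"
    using prox_in_domain[OF assms] .
  from fenchel_conjugate_prox[OF assms this] show ?thesis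
    by (simp add: potential_conjugate_def)
qed

lemma inner_le_potential_conjugate:
  fixes \<Psi> :: "'a::euclidean_space \<Rightarrow> ereal"
  assumes "admissible_potential \<Psi>" "\<Psi> u = ereal s"
  shows "u \<bullet> z \<le> 1/2 * (norm u)\<^sup>2 + s + potential_conjugate \<Psi> z"
  using fenchel_young[of \<Psi>, OF assms(2), of z] fenchel_conjugate_finite[OF assms(1), of z] by simp

text \<open>The lower bound is Fenchel-Young at the pair \<open>prox \<Psi> z\<close>,
  \<open>z'\<close>; the upper bound is \<open>fenchel_conjugate_le\<close>. Both rest on equality
  in Fenchel-Young at \<open>prox \<Psi> z\<close>, \<open>z\<close>.\<close>

lemma potential_conjugate_gradient_bounds:
  fixes \<Psi> :: "'a::euclidean_space \<Rightarrow> ereal"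
  assumes adm: "admissible_potential \<Psi>"
  shows "potential_conjugate \<Psi> z + prox \<Psi> z \<bullet> (z' - z) \<le> potential_conjugate \<Psi> z'"
    and "potential_conjugate \<Psi> z'
      \<le> potential_conjugate \<Psi> z + prox \<Psi> z \<bullet> (z' - z) + 1/2 * (norm (z' - z))\<^sup>2"
proof -
  obtain r where r: "\<Psi> (prox \<Psi> z) = ereal r"
    using prox_in_domain[OF adm] .
  have "potential_conjugate \<Psi> z = prox \<Psi> z \<bullet> z - 1/2 * (norm (prox \<Psi> z))\<^sup>2 - r"
    unfolding potential_conjugate_def fenchel_conjugate_prox[OF adm r] by simp
  then show "potential_conjugate \<Psi> z + prox \<Psi> z \<bullet> (z' - z) \<le> potential_conjugate \<Psi> z'"
    and "potential_conjugate \<Psi> z'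
      \<le> potential_conjugate \<Psi> z + prox \<Psi> z \<bullet> (z' - z) + 1/2 * (norm (z' - z))\<^sup>2"
    using inner_le_potential_conjugate[OF adm r, of z'] fenchel_conjugate_le[OF adm r, of z']
    unfolding fenchel_conjugate_finite[OF adm] by (simp_all add: inner_diff_right)
qed

section \<open>The Bregman loss and optimality of regularised solutions\<close>

lemma bregman_loss_eq:
  fixes \<Psi> :: "'a::euclidean_space \<Rightarrow> ereal"
  assumes "admissible_potential \<Psi>" "\<Psi> u = ereal s"
  shows "bregman_loss \<Psi> u z
    = ereal (1/2 * (norm u)\<^sup>2 + s + potential_conjugate \<Psi> z - u \<bullet> z)"
  unfolding bregman_loss_def fenchel_conjugate_finite[OF assms(1)] by (simp add: assms(2))

lemma effective_domain_potentialE: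
  assumes "admissible_potential \<Psi>" "u \<in> effective_domain \<Psi>"
  obtains s where "\<Psi> u = ereal s"
  using assms that unfolding admissible_potential_def proper_fun_def effective_domain_def
  by (cases "\<Psi> u") auto

lemma regularised_solution_finite:
  fixes W :: "real^'n^'m"
  assumes adm: "admissible_potential \<Psi>" and R: "proper_fun R" and \<alpha>: "\<alpha> > 0"
    and g: "g \<in> effective_domain \<Psi>" and x: "x \<in> regularisation_op R \<Psi> W b \<alpha> g"
  obtains r where "R x = ereal r"
proof -
  obtain s where s: "\<Psi> g = ereal s"
    using effective_domain_potentialE[OF adm g] .
  let ?f = "\<lambda>x. 1/2 * (norm g)\<^sup>2 + s + potential_conjugate \<Psi> (W *v x + b) - g \<bullet> (W *v x + b)"
  obtain u where u: "R u < \<infinity>"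
    using R by (auto simp: proper_fun_def)
  have "ereal (?f x) + ereal \<alpha> * R x \<le> ereal (?f u) + ereal \<alpha> * R u"
    using x by (simp add: regularisation_op_def is_arg_min_linorder bregman_loss_eq[OF adm s])
  then show ?thesis
    using that u R \<alpha> by (cases "R x"; cases "R u") (auto simp: proper_fun_def)
qed

text \<open>The objective is divided by \<open>\<alpha>\<close>, so that \<open>R\<close> becomes
  the convex summand and the scaled loss the smooth one. The quadratic bound on the conjugate,
  composed with \<open>x \<mapsto> W x + b\<close>, provides the constant.\<close>

lemma regularised_solution_subgradient:
  fixes W :: "real^'n^'m"
  assumes adm: "admissible_potential \<Psi>" and R: "proper_fun R" "convex_fun R" and \<alpha>: "\<alpha> > 0"
    and g: "g \<in> effective_domain \<Psi>" and x: "x \<in> regularisation_op R \<Psi> W b \<alpha> g"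
  shows "(1/\<alpha>) *\<^sub>R (transpose W *v (g - prox \<Psi> (W *v x + b))) \<in> subdifferential R x"
proof -
  obtain s where s: "\<Psi> g = ereal s"
    using effective_domain_potentialE[OF adm g] .
  obtain r where r: "R x = ereal r"
    using regularised_solution_finite[OF adm R(1) \<alpha> g x] .
  let ?f = "\<lambda>x. 1/2 * (norm g)\<^sup>2 + s + potential_conjugate \<Psi> (W *v x + b) - g \<bullet> (W *v x + b)"
  let ?d = "transpose W *v (prox \<Psi> (W *v x + b) - g)"
  \<comment> \<open>An operator bound for \<open>W\<close> turns the error in \<open>W *v h\<close>
    into one in \<open>h\<close>, whence \<open>C = K\<^sup>2 / (2 * \<alpha>)\<close>.\<close>
  obtain K where K: "\<And>h. norm (W *v h) \<le> norm h * K"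
    using bounded_linear.bounded[OF matrix_vector_mul_bounded_linear[of W]] by blast
  have "- ((1/\<alpha>) *\<^sub>R ?d) \<in> subdifferential R x"
  proof (rule subgradient_of_minimiser[OF R(2,1), where f = "\<lambda>x. ?f x / \<alpha>" and C = "K\<^sup>2 / (2 * \<alpha>)"])
    fix u
    have min: "ereal (?f x) + ereal \<alpha> * R x \<le> ereal (?f u) + ereal \<alpha> * R u"
      using x by (simp add: regularisation_op_def is_arg_min_linorder bregman_loss_eq[OF adm s])
    show "ereal (?f x / \<alpha>) + R x \<le> ereal (?f u / \<alpha>) + R u"
    proof (cases "R u")
      case (real t)
      with min r have "?f x + \<alpha> * r \<le> ?f u + \<alpha> * t"
        by simp
      then have "(?f x + \<alpha> * r) / \<alpha> \<le> (?f u + \<alpha> * t) / \<alpha>"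
        using \<alpha> by (simp add: divide_right_mono)
      then have "?f x / \<alpha> + r \<le> ?f u / \<alpha> + t"
        using \<alpha> by (simp add: add_divide_distrib)
      then show ?thesis
        by (simp add: r real)
    qed (use R in \<open>auto simp: proper_fun_def\<close>)
  next
    fix h
    have eq: "W *v (x + h) + b = (W *v x + b) + W *v h"
      by (simp add: matrix_vector_right_distrib)
    have "(norm (W *v h))\<^sup>2 \<le> (norm h * K)\<^sup>2"
      using K by (rule power_mono) simp
    then have "1/2 * (norm (W *v h))\<^sup>2 \<le> K\<^sup>2 / 2 * (norm h)\<^sup>2"
      by (simp add: power_mult_distrib mult.commute)
    moreover have "?d \<bullet> h = prox \<Psi> (W *v x + b) \<bullet> (W *v h) - g \<bullet> (W *v h)"
      by (simp add: dot_lmul_matrix inner_diff_left)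
    ultimately have "?f (x + h) \<le> ?f x + ?d \<bullet> h + K\<^sup>2 / 2 * (norm h)\<^sup>2"
      using potential_conjugate_gradient_bounds(2)[OF adm, of "W *v (x + h) + b" "W *v x + b"]
      unfolding eq by (simp add: inner_add_right)
    then have "?f (x + h) / \<alpha> \<le> (?f x + ?d \<bullet> h + K\<^sup>2 / 2 * (norm h)\<^sup>2) / \<alpha>"
      using \<alpha> by (simp add: divide_right_mono)
    also have "\<dots> = ?f x / \<alpha> + ((1/\<alpha>) *\<^sub>R ?d) \<bullet> h + K\<^sup>2 / (2 * \<alpha>) * (norm h)\<^sup>2"
      by (simp only: add_divide_distrib inner_scaleR_left) simp
    finally show "?f (x + h) / \<alpha>
      \<le> ?f x / \<alpha> + ((1/\<alpha>) *\<^sub>R ?d) \<bullet> h + K\<^sup>2 / (2 * \<alpha>) * (norm h)\<^sup>2" .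
  qed
  moreover have "- ((1/\<alpha>) *\<^sub>R ?d)
      = (1/\<alpha>) *\<^sub>R (transpose W *v (g - prox \<Psi> (W *v x + b)))"
    by (simp add: matrix_vector_mult_diff_distrib flip: scaleR_minus_right del: transpose_matrix_vector)
  ultimately show ?thesis
    by simp
qed

section \<open>Symmetric Bregman distance and the dual estimate\<close>

text \<open>Finiteness of both values lets them cancel in the extended reals.\<close>

lemma symm_bregman_distance_eq:
  assumes "R x = ereal r" "R x' = ereal r'"
  shows "symm_bregman_distance R q q' x x' = ereal ((x - x') \<bullet> (q - q'))"
  by (simp add: symm_bregman_distance_def bregman_distance_def assms algebra_simps inner_commute)

lemma subdifferential_nonempty_finite:
  assumes "proper_fun F" "q \<in> subdifferential F x"
  obtains r where "F x = ereal r"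
proof -
  obtain u where "F u < \<infinity>"
    using assms(1) by (auto simp: proper_fun_def)
  moreover have "F x + ereal (q \<bullet> (u - x)) \<le> F u"
    using assms(2) by (simp add: subdifferential_def)
  ultimately show ?thesis
    using that assms(1) by (cases "F x") (auto simp: proper_fun_def)
qed

text \<open>Adding Fenchel-Young at \<open>(g + w, z')\<close> and \<open>(g - w, z)\<close> leaves
  \<open>(z' - z) \<bullet> w\<close> beside the terms of the two losses; the parallelogram identity
  reduces the squared norms to those of \<open>g\<close> and \<open>w\<close>.\<close>

lemma bregman_loss_dual_estimate:
  fixes \<Psi> :: "'a::euclidean_space \<Rightarrow> ereal"
  assumes adm: "admissible_potential \<Psi>"
    and g: "\<Psi> g = ereal s" "\<Psi> (g + w) = ereal s1" "\<Psi> (g - w) = ereal s2"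
    and B: "\<And>z. B z = 1/2 * (norm g)\<^sup>2 + s + potential_conjugate \<Psi> z - g \<bullet> z"
  shows "(z' - z) \<bullet> w \<le> B z + B z' + (norm w)\<^sup>2 + (s1 + s2 - 2 * s)"
proof -
  have "(norm (g + w))\<^sup>2 + (norm (g - w))\<^sup>2 = 2 * (norm g)\<^sup>2 + 2 * (norm w)\<^sup>2"
    by (simp add: power2_norm_eq_inner algebra_simps)
  moreover have "(g + w) \<bullet> z' \<le> 1/2 * (norm (g + w))\<^sup>2 + s1 + potential_conjugate \<Psi> z'"
    and "(g - w) \<bullet> z \<le> 1/2 * (norm (g - w))\<^sup>2 + s2 + potential_conjugate \<Psi> z"
    using inner_le_potential_conjugate[OF adm] g by blast+
  ultimately show ?thesis
    unfolding B inner_diff_left inner_add_left by (simp add: inner_commute)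
qed

section \<open>The error estimate\<close>

theorem theorem2:
  fixes W :: "real^'n^'m" and b :: "real^'m" and \<alpha> \<delta> :: real
    and R :: "real^'n \<Rightarrow> ereal" and \<Psi> :: "real^'m \<Rightarrow> ereal"
    and y y\<delta> v_dag :: "real^'m" and x_dag x\<alpha> p\<alpha> p_dag :: "real^'n"
  assumes "\<alpha> > 0" and "\<delta> \<ge> 0"
    and "admissible_regulariser R"
    and "admissible_potential \<Psi>"
    and "coercivity_condition R \<Psi> W b"
    and "y \<in> effective_domain \<Psi>" and "y\<delta> \<in> effective_domain \<Psi>"
    and "y = prox \<Psi> (W *v x_dag + b)" and "x_dag \<in> selection_op R \<Psi> W b y"
    and "p_dag = transpose W *v v_dag" and "p_dag \<in> subdifferential R x_dag"
    and "bregman_loss \<Psi> y\<delta> (W *v x_dag + b) \<le> ereal (\<delta>\<^sup>2)"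
    and "x\<alpha> \<in> regularisation_op R \<Psi> W b \<alpha> y\<delta>"
    and "p\<alpha> = (1/\<alpha>) *\<^sub>R (transpose W *v (y\<delta> - prox \<Psi> (W *v x\<alpha> + b)))"
  shows "p\<alpha> \<in> subdifferential R x\<alpha> \<and>
    symm_bregman_distance R p\<alpha> p_dag x\<alpha> x_dag = ereal ((x\<alpha> - x_dag) \<bullet> (p\<alpha> - p_dag)) \<and>
    (\<forall>c::real. 0 < c \<longrightarrow> c \<le> 1 \<longrightarrow>
       y\<delta> + (\<alpha>/c) *\<^sub>R v_dag \<in> effective_domain \<Psi> \<longrightarrow>
       y\<delta> - (\<alpha>/c) *\<^sub>R v_dag \<in> effective_domain \<Psi> \<longrightarrow>
       ereal (1 - c) * bregman_loss \<Psi> y\<delta> (W *v x\<alpha> + b)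
         + ereal \<alpha> * symm_bregman_distance R p\<alpha> p_dag x\<alpha> x_dag
       \<le> ereal ((1 + c) * \<delta>\<^sup>2 + \<alpha>\<^sup>2 / c * (norm v_dag)\<^sup>2)
         + ereal (2 * c) * burbea_rao \<Psi> (y\<delta> + (\<alpha>/c) *\<^sub>R v_dag) (y\<delta> - (\<alpha>/c) *\<^sub>R v_dag))"
proof -
  have R: "proper_fun R" "convex_fun R"
    using assms(3) by (simp_all add: admissible_regulariser_def)
  note adm = \<open>admissible_potential \<Psi>\<close>
  obtain r where r: "R x\<alpha> = ereal r"
    using regularised_solution_finite[OF adm R(1) \<open>\<alpha> > 0\<close> assms(7,13)] .
  obtain r' where r': "R x_dag = ereal r'"
    using subdifferential_nonempty_finite[OF R(1) assms(11)] .
  have sub: "p\<alpha> \<in> subdifferential R x\<alpha>"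
    unfolding assms(14)
    by (rule regularised_solution_subgradient[OF adm R \<open>\<alpha> > 0\<close> assms(7,13)])
  have symm: "symm_bregman_distance R p\<alpha> p_dag x\<alpha> x_dag = ereal ((x\<alpha> - x_dag) \<bullet> (p\<alpha> - p_dag))"
    using symm_bregman_distance_eq[of R, OF r r'] .
  obtain s where s: "\<Psi> y\<delta> = ereal s"
    using effective_domain_potentialE[OF adm assms(7)] .
  define B where "B z = 1/2 * (norm y\<delta>)\<^sup>2 + s + potential_conjugate \<Psi> z - y\<delta> \<bullet> z" for z
  have loss: "bregman_loss \<Psi> y\<delta> z = ereal (B z)" for z
    by (simp add: B_def bregman_loss_eq[OF adm s])
  define z\<alpha> where "z\<alpha> = W *v x\<alpha> + b"
  define z where "z = W *v x_dag + b"
  have noise: "B z \<le> \<delta>\<^sup>2"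
    using assms(12) by (simp add: loss z_def)
  have diff: "W *v (x\<alpha> - x_dag) = z\<alpha> - z"
    by (simp add: z\<alpha>_def z_def matrix_vector_mult_diff_distrib)
  have transpose_inner: "(x\<alpha> - x_dag) \<bullet> (transpose W *v u) = (z\<alpha> - z) \<bullet> u" for u
    by (simp add: dot_lmul_matrix inner_commute flip: diff)
  have "\<alpha> * ((x\<alpha> - x_dag) \<bullet> (p\<alpha> - p_dag))
      = (z\<alpha> - z) \<bullet> (y\<delta> - prox \<Psi> z\<alpha>) - \<alpha> * ((z\<alpha> - z) \<bullet> v_dag)"
    unfolding assms(10,14) z\<alpha>_def[symmetric]
    using \<open>\<alpha> > 0\<close> by (simp only: inner_diff_right[of _ "scaleR _ _"] inner_scaleR_right transpose_inner)
      (simp add: algebra_simps)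
  \<comment> \<open>\<open>B\<close> differs from the conjugate by an affine function, so it
    satisfies the gradient inequality at \<open>z\<alpha>\<close> with gradient
    \<open>prox \<Psi> z\<alpha> - y\<delta>\<close>.\<close>
  moreover have "(z\<alpha> - z) \<bullet> (y\<delta> - prox \<Psi> z\<alpha>) \<le> B z - B z\<alpha>"
    using potential_conjugate_gradient_bounds(1)[OF adm, of z\<alpha> z]
    by (simp add: B_def algebra_simps inner_commute)
  ultimately have descent: "\<alpha> * ((x\<alpha> - x_dag) \<bullet> (p\<alpha> - p_dag))
      \<le> B z - B z\<alpha> + \<alpha> * ((z - z\<alpha>) \<bullet> v_dag)"
    by (simp add: inner_diff_left algebra_simps)
  have "ereal (1 - c) * bregman_loss \<Psi> y\<delta> (W *v x\<alpha> + b)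
         + ereal \<alpha> * symm_bregman_distance R p\<alpha> p_dag x\<alpha> x_dag
       \<le> ereal ((1 + c) * \<delta>\<^sup>2 + \<alpha>\<^sup>2 / c * (norm v_dag)\<^sup>2)
         + ereal (2 * c) * burbea_rao \<Psi> (y\<delta> + (\<alpha>/c) *\<^sub>R v_dag) (y\<delta> - (\<alpha>/c) *\<^sub>R v_dag)"
    if c: "0 < c" "y\<delta> + (\<alpha>/c) *\<^sub>R v_dag \<in> effective_domain \<Psi>"
      "y\<delta> - (\<alpha>/c) *\<^sub>R v_dag \<in> effective_domain \<Psi>" for c
  proof -
    let ?w = "(\<alpha>/c) *\<^sub>R v_dag"
    obtain s1 where s1: "\<Psi> (y\<delta> + ?w) = ereal s1"
      using effective_domain_potentialE[OF adm c(2)] .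
    obtain s2 where s2: "\<Psi> (y\<delta> - ?w) = ereal s2"
      using effective_domain_potentialE[OF adm c(3)] .
    have mid: "(y\<delta> + ?w + (y\<delta> - ?w)) /\<^sub>R 2 = y\<delta>"
      by (simp flip: scaleR_2)
    have "burbea_rao \<Psi> (y\<delta> + ?w) (y\<delta> - ?w) = ereal (1/2) * (ereal s1 + ereal s2 - ereal 2 * ereal s)"
      unfolding burbea_rao_def mid s1 s2 s by simp
    then have br: "burbea_rao \<Psi> (y\<delta> + ?w) (y\<delta> - ?w) = ereal (1/2 * (s1 + s2 - 2 * s))"
      by simp
    \<comment> \<open>The scaling \<open>\<alpha>/c\<close> in \<open>?w\<close> makes the left-hand
      side equal to the last term of \<open>descent\<close>. The losses enter with factor
      \<open>c\<close>, so \<open>descent\<close> retains \<open>1 - c\<close> times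
      \<open>B z\<alpha>\<close> and gathers \<open>1 + c\<close> times \<open>B z\<close>.\<close>
    have "c * ((z - z\<alpha>) \<bullet> ?w) \<le> c * (B z\<alpha> + B z + (norm ?w)\<^sup>2 + (s1 + s2 - 2 * s))"
      using c(1) by (intro mult_left_mono bregman_loss_dual_estimate[OF adm s s1 s2 B_def]) simp
    moreover have "c * ((z - z\<alpha>) \<bullet> ?w) = \<alpha> * ((z - z\<alpha>) \<bullet> v_dag)"
      using c(1) by simp
    moreover have "c * (norm ?w)\<^sup>2 = \<alpha>\<^sup>2 / c * (norm v_dag)\<^sup>2"
      using c(1) by (simp add: power_mult_distrib power_divide power2_eq_square)
    moreover have "(1 + c) * B z \<le> (1 + c) * \<delta>\<^sup>2"
      using noise c(1) by simp
    ultimately have "(1 - c) * B z\<alpha> + \<alpha> * ((x\<alpha> - x_dag) \<bullet> (p\<alpha> - p_dag))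
      \<le> (1 + c) * \<delta>\<^sup>2 + \<alpha>\<^sup>2 / c * (norm v_dag)\<^sup>2 + c * (s1 + s2 - 2 * s)"
      using descent by (simp add: algebra_simps)
    then show ?thesis
      unfolding symm br loss z\<alpha>_def[symmetric] by simp
  qed
  with sub symm show ?thesis
    by blast
qed

end
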